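(* Consider the implicitly constrained least-squares problem $\min_{u\in\mathbb{R}^n}\hat J(u)$, $\hat J(u)=\frac12\|\hat R(u)\|^2$, and the regularization method described in the context. Assume that: (1) $\hat J$ is continuously differentiable and $\nabla\hat J$ is $L$-Lipschitz continuous for some $L>0$; (2) there is $M_H>0$ such that $\|H_k\|\le M_H$ for all $k$; (3) $H_k$ is positive semidefinite for all $k$; (4) for some $\theta\in[0,1)$ and for every $k$, the step $s_k$ satisfies $$(H_k+\gamma_kI)s_k=-g_k+t_k,\qquad \|t_k\|\le\theta\sqrt{\frac{\gamma_k}{\|H_k\|+\gamma_k}}\,\|g_k\|.$$ For $\epsilon_g\in(0,1)$ and $\epsilon_R>0$, let $\mathcal{S}^{in}_{\epsilon_g,\epsilon_R}$ (resp. $\mathcal{U}^{in}_{\epsilon_g,\epsilon_R}$) be the set of successful (resp. unsuccessful) iterations $k$ for which $u_k$ does not satisfy $$\|\hat R(u_k)\|\le\epsilon_R\quad\text{or}\quad \frac{\|\hat G(u_k)^{\mathrm T}\hat R(u_k)\|}{\|\hat R(u_k)\|}\le\epsilon_g. \qquad ( * )$$ Then the number of successful iterations (and inexact step calculations) before reaching an iterate satisfying $( * )$ satisfies $$|\mathcal{S}^{in}_{\epsilon_g,\epsilon_R}|=\mathcal{O}\left(\frac{1}{(1-\theta^2)^2}\log(\epsilon_R^{-1})\,\epsilon_g^{-2}\right),$$ and the total number of iterations (and residual evaluations) before reaching such an iterate satisfies $$|\mathcal{S}^{in}_{\epsilon_g,\epsilon_R}|+|\mathcal{U}^{in}_{\epsilon_g,\epsilon_R}|=\mathcal{O}\left(\frac{1}{(1-\theta^2)^2}\log(\epsilon_R^{-1})\,\epsilon_g^{-2}\right).$$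 Here $\mathcal{O}$ means: there exist constants $C>0$ and $\bar\epsilon\in(0,1)$, depending only on $L$, $M_H$, $\eta$, $\gamma_0$, $\gamma_{\min}$ and $\hat J(u_0)$ (not on $\theta$), such that each of the quantities (including the corresponding evaluation counts) is at most $C(1-\theta^2)^{-2}\log(\epsilon_R^{-1})\epsilon_g^{-2}$ for all $\epsilon_g\in(0,1)$ and $\epsilon_R\in(0,\bar\epsilon]$.
   Context: Setting. $\|\cdot\|$ is the Euclidean norm for vectors and the spectral norm for matrices. $R:\mathbb{R}^{n_y}\times\mathbb{R}^n\to\mathbb{R}^m$ and $c:\mathbb{R}^{n_y}\times\mathbb{R}^n\to\mathbb{R}^p$ are given, and for each $u\in\mathbb{R}^n$ the equation $c(y,u)=0$ has a unique solution $y(u)$. Put $\hat R(u)=R(y(u),u)$, $\hat J(u)=\frac12\|\hat R(u)\|^2$, and let $\hat G(u)$ be the Jacobian of $\hat R$ at $u$, so that $\nabla\hat J(u)=\hat G(u)^{\mathrm T}\hat R(u)$. Method. Inputs: $u_0\in\mathbb{R}^n$, $\gamma_0>0$, $0<\gamma_{\min}\le\gamma_0$, $\eta\in(0,1)$. Compute $y(u_0)$, $R_0=\hat R(u_0)$, $G_0=\hat G(u_0)$. For $k=0,1,2,\dots$, with $R_k=\hat R(u_k)$, $G_k=\hat G(u_k)$, $g_k=G_k^{\mathrm T}R_k=\nabla\hat J(u_k)$ and $H_k\in\mathbb{R}^{n\times n}$ a symmetric matrix: compute a step $s_k$ by (approximately) minimizing over $s\in\mathbb{R}^n$ the model $$m_k(u_k+s)=\tfrac12\|R_k\|^2+g_k^{\mathrm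 T}s+\tfrac12 s^{\mathrm T}(H_k+\gamma_kI)s;$$ compute $y(u_k+s_k)$ and the ratio $\rho_k=\dfrac{\hat J(u_k)-\hat J(u_k+s_k)}{m_k(u_k)-m_k(u_k+s_k)}$. If $\rho_k\ge\eta$, set $u_{k+1}=u_k+s_k$, $\gamma_{k+1}=\max\{0.5\gamma_k,\gamma_{\min}\}$ and evaluate $R_{k+1},G_{k+1}$; otherwise set $u_{k+1}=u_k$, $\gamma_{k+1}=2\gamma_k$. (If $g_k=0$, then $s_k=0$, the ratio is $0/0$, and $u_{k+1}=u_k$ regardless.) Iteration $k$ is successful if $u_{k+1}\ne u_k$ and unsuccessful otherwise. Cost counts: the residual $\hat R$ is evaluated once at $u_0$ and once per iteration at the trial point $u_k+s_k$; the bound on successful iterations counts the step calculations of successful iterations. When $\hat R(u_k)=0$ the first alternative of $( * )$ holds, so the quotient is only considered for $\hat R(u_k)\neq 0$. *)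

theory Defs
  imports
    "HOL-Analysis.L2_Norm"
    "Jordan_Normal_Form.Matrix"
begin

text \<open>
  The constants of the complexity bound must not depend on the dimensions of the problem, so the
  dimensions have to be quantified inside the formula.  Vectors and matrices are therefore those of
  \<^theory>\<open>Jordan_Normal_Form.Matrix\<close>: the space of real \<open>n\<close>-vectors is \<open>carrier_vec n\<close>.  That
  library has no norm and no derivative, so these are defined first.
\<close>

definition enorm :: "real vec \<Rightarrow> real" where
  "enorm v = L2_set (\<lambda>i. v $ i) {..<dim_vec v}"

definition spectral_norm :: "real mat \<Rightarrow> real" where
  "spectral_norm A = (SUP x \<in> {x \<in> carrier_vec (dim_col A). enorm x \<le> 1}. enorm (A *\<^sub>v x))"

definition symmetric_psd :: "nat \<Rightarrow> real mat \<Rightarrow> bool" where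
  "symmetric_psd n A \<longleftrightarrow>
     A \<in> carrier_mat n n \<and> transpose_mat A = A \<and> (\<forall>x \<in> carrier_vec n. 0 \<le> x \<bullet> (A *\<^sub>v x))"

text \<open>Frechet derivative at \<open>x\<close>, represented by its Jacobian matrix.\<close>

definition has_jacobian ::
    "nat \<Rightarrow> nat \<Rightarrow> (real vec \<Rightarrow> real vec) \<Rightarrow> real mat \<Rightarrow> real vec \<Rightarrow> bool" where
  "has_jacobian n m F A x \<longleftrightarrow>
     A \<in> carrier_mat m n \<and>
     (\<forall>e>0. \<exists>d>0. \<forall>h \<in> carrier_vec n.
        enorm h < d \<longrightarrow> enorm (F (x + h) - F x - A *\<^sub>v h) \<le> e * enorm h)"

text \<open>Frechet derivative of a scalar function, represented by its gradient.\<close>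

definition has_gradient :: "nat \<Rightarrow> (real vec \<Rightarrow> real) \<Rightarrow> real vec \<Rightarrow> real vec \<Rightarrow> bool" where
  "has_gradient n f g x \<longleftrightarrow>
     g \<in> carrier_vec n \<and>
     (\<forall>e>0. \<exists>d>0. \<forall>h \<in> carrier_vec n.
        enorm h < d \<longrightarrow> \<bar>f (x + h) - f x - g \<bullet> h\<bar> \<le> e * enorm h)"

definition continuously_differentiable ::
    "nat \<Rightarrow> (real vec \<Rightarrow> real) \<Rightarrow> (real vec \<Rightarrow> real vec) \<Rightarrow> bool" where
  "continuously_differentiable n f grad \<longleftrightarrow>
     (\<forall>x \<in> carrier_vec n. has_gradient n f (grad x) x) \<and>
     (\<forall>x \<in> carrier_vec n. \<forall>e>0. \<exists>d>0. \<forall>y \<in> carrier_vec n.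
        enorm (y - x) < d \<longrightarrow> enorm (grad y - grad x) < e)"

definition lipschitz_map :: "nat \<Rightarrow> real \<Rightarrow> (real vec \<Rightarrow> real vec) \<Rightarrow> bool" where
  "lipschitz_map n L g \<longleftrightarrow>
     (\<forall>x \<in> carrier_vec n. \<forall>y \<in> carrier_vec n. enorm (g x - g y) \<le> L * enorm (x - y))"

definition implicit_problem ::
    "nat \<Rightarrow> nat \<Rightarrow> nat \<Rightarrow> nat \<Rightarrow> (real vec \<Rightarrow> real vec \<Rightarrow> real vec) \<Rightarrow>
     (real vec \<Rightarrow> real vec \<Rightarrow> real vec) \<Rightarrow> bool" where
  "implicit_problem ny n m p R c \<longleftrightarrow>
     (\<forall>y \<in> carrier_vec ny. \<forall>u \<in> carrier_vec n. R y u \<in> carrier_vec m \<and> c y u \<in> carrier_vec p) \<and>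
     (\<forall>u \<in> carrier_vec n. \<exists>!y. y \<in> carrier_vec ny \<and> c y u = 0\<^sub>v p)"

definition state :: "nat \<Rightarrow> nat \<Rightarrow> (real vec \<Rightarrow> real vec \<Rightarrow> real vec) \<Rightarrow> real vec \<Rightarrow> real vec" where
  "state ny p c u = (THE y. y \<in> carrier_vec ny \<and> c y u = 0\<^sub>v p)"

definition reduced_residual ::
    "nat \<Rightarrow> nat \<Rightarrow> (real vec \<Rightarrow> real vec \<Rightarrow> real vec) \<Rightarrow>
     (real vec \<Rightarrow> real vec \<Rightarrow> real vec) \<Rightarrow> real vec \<Rightarrow> real vec" where
  "reduced_residual ny p R c u = R (state ny p c u) u"

text \<open>From here on \<open>r\<close> is the reduced residual and \<open>G\<close> maps a point to the Jacobian of \<open>r\<close> there.\<close>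

definition objective :: "(real vec \<Rightarrow> real vec) \<Rightarrow> real vec \<Rightarrow> real" where
  "objective r u = 1/2 * (enorm (r u))\<^sup>2"

definition grad_GR :: "(real vec \<Rightarrow> real vec) \<Rightarrow> (real vec \<Rightarrow> real mat) \<Rightarrow> real vec \<Rightarrow> real vec" where
  "grad_GR r G u = transpose_mat (G u) *\<^sub>v r u"

definition regularized :: "nat \<Rightarrow> real mat \<Rightarrow> real \<Rightarrow> real mat" where
  "regularized n H \<gamma> = H + \<gamma> \<cdot>\<^sub>m 1\<^sub>m n"

text \<open>\<open>model n r G u H \<gamma> s\<close> is the value of the model built at \<open>u\<close> in the point \<open>u + s\<close>.\<close>

definition model ::
    "nat \<Rightarrow> (real vec \<Rightarrow> real vec) \<Rightarrow> (real vec \<Rightarrow> real mat) \<Rightarrow>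
     real vec \<Rightarrow> real mat \<Rightarrow> real \<Rightarrow> real vec \<Rightarrow> real" where
  "model n r G u H \<gamma> s =
     1/2 * (enorm (r u))\<^sup>2 + grad_GR r G u \<bullet> s + 1/2 * (s \<bullet> (regularized n H \<gamma> *\<^sub>v s))"

definition ratio ::
    "nat \<Rightarrow> (real vec \<Rightarrow> real vec) \<Rightarrow> (real vec \<Rightarrow> real mat) \<Rightarrow>
     real vec \<Rightarrow> real mat \<Rightarrow> real \<Rightarrow> real vec \<Rightarrow> real" where
  "ratio n r G u H \<gamma> s =
     (objective r u - objective r (u + s)) /
     (model n r G u H \<gamma> (0\<^sub>v n) - model n r G u H \<gamma> s)"

text \<open>
  At a stationary iterate the step is zero and the ratio is \<open>0/0\<close>: the iterate is kept.  The value
  of the next regularization parameter is then immaterial, and either update is allowed, so that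
  nothing hinges on the convention \<open>0/0 = 0\<close>.
\<close>

definition regularization_run ::
    "nat \<Rightarrow> (real vec \<Rightarrow> real vec) \<Rightarrow> (real vec \<Rightarrow> real mat) \<Rightarrow>
     real vec \<Rightarrow> real \<Rightarrow> real \<Rightarrow> real \<Rightarrow>
     (nat \<Rightarrow> real mat) \<Rightarrow> (nat \<Rightarrow> real vec) \<Rightarrow> (nat \<Rightarrow> real vec) \<Rightarrow> (nat \<Rightarrow> real) \<Rightarrow> bool" where
  "regularization_run n r G u0 \<gamma>0 \<gamma>min \<eta> H s u \<gamma> \<longleftrightarrow>
     u 0 = u0 \<and> \<gamma> 0 = \<gamma>0 \<and>
     (\<forall>k. H k \<in> carrier_mat n n \<and> transpose_mat (H k) = H k \<and> s k \<in> carrier_vec n \<and>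
        (if grad_GR r G (u k) = 0\<^sub>v n then
           s k = 0\<^sub>v n \<and> u (Suc k) = u k \<and>
           (\<gamma> (Suc k) = max (0.5 * \<gamma> k) \<gamma>min \<or> \<gamma> (Suc k) = 2 * \<gamma> k)
         else if ratio n r G (u k) (H k) (\<gamma> k) (s k) \<ge> \<eta> then
           u (Suc k) = u k + s k \<and> \<gamma> (Suc k) = max (0.5 * \<gamma> k) \<gamma>min
         else
           u (Suc k) = u k \<and> \<gamma> (Suc k) = 2 * \<gamma> k))"

definition inexact_step ::
    "nat \<Rightarrow> (real vec \<Rightarrow> real vec) \<Rightarrow> (real vec \<Rightarrow> real mat) \<Rightarrow> real \<Rightarrow>
     real vec \<Rightarrow> real mat \<Rightarrow> real \<Rightarrow> real vec \<Rightarrow> bool" where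
  "inexact_step n r G \<theta> u H \<gamma> s \<longleftrightarrow>
     (\<exists>t \<in> carrier_vec n.
        regularized n H \<gamma> *\<^sub>v s = - grad_GR r G u + t \<and>
        enorm t \<le> \<theta> * sqrt (\<gamma> / (spectral_norm H + \<gamma>)) * enorm (grad_GR r G u))"

text \<open>
  For \<open>r u = 0\<close> the first alternative holds (for \<open>\<epsilon>R \<ge> 0\<close>), so the value of the quotient
  does not matter.
\<close>

definition approx_stationary ::
    "(real vec \<Rightarrow> real vec) \<Rightarrow> (real vec \<Rightarrow> real mat) \<Rightarrow> real \<Rightarrow> real \<Rightarrow> real vec \<Rightarrow> bool" where
  "approx_stationary r G \<epsilon>g \<epsilon>R u \<longleftrightarrow>
     enorm (r u) \<le> \<epsilon>R \<or> enorm (grad_GR r G u) / enorm (r u) \<le> \<epsilon>g"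

definition successful_its ::
    "(real vec \<Rightarrow> real vec) \<Rightarrow> (real vec \<Rightarrow> real mat) \<Rightarrow> (nat \<Rightarrow> real vec) \<Rightarrow> real \<Rightarrow> real \<Rightarrow> nat set" where
  "successful_its r G u \<epsilon>g \<epsilon>R = {k. u (Suc k) \<noteq> u k \<and> \<not> approx_stationary r G \<epsilon>g \<epsilon>R (u k)}"

definition unsuccessful_its ::
    "(real vec \<Rightarrow> real vec) \<Rightarrow> (real vec \<Rightarrow> real mat) \<Rightarrow> (nat \<Rightarrow> real vec) \<Rightarrow> real \<Rightarrow> real \<Rightarrow> nat set" where
  "unsuccessful_its r G u \<epsilon>g \<epsilon>R = {k. u (Suc k) = u k \<and> \<not> approx_stationary r G \<epsilon>g \<epsilon>R (u k)}"

text \<open>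
  Each iteration computes one step and evaluates the residual once, at the trial point; the residual
  is evaluated once more at the starting point.
\<close>

definition step_calculations :: "nat set \<Rightarrow> nat" where
  "step_calculations I = (\<Sum>k\<in>I. 1)"

definition residual_evaluations :: "nat set \<Rightarrow> nat" where
  "residual_evaluations I = 1 + (\<Sum>k\<in>I. 1)"

end

theory Submission
  imports Defs
begin

text \<open>
  The bound rests on three facts about an iterate \<open>u k\<close> with nonzero gradient \<open>g k\<close>.

  First, an inexact step still decreases the model by at least
  \<open>(1 - \<theta>\<^sup>2) / 2 * enorm (g k) ^ 2 / (spectral_norm (H k) + \<gamma> k)\<close>: the model is strongly convex with
  modulus \<open>\<gamma> k\<close>, so a small gradient of the model at \<open>s k\<close> means a nearly minimal value
  (\<open>inexact_step_model_decrease\<close>).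

  Second, the step is accepted as soon as \<open>\<gamma> k \<ge> L\<close>, because the model then exceeds the upper
  bound of the descent lemma by a positive semidefinite quadratic form, and so dominates the
  objective (\<open>accepted_if_large_\<gamma>\<close>).  Hence \<open>\<gamma> k \<le> max \<gamma>0 (2 * L)\<close>, and the decrease in the first
  fact is at least a fixed multiple of \<open>(1 - \<theta>\<^sup>2) * enorm (g k) ^ 2\<close>.

  Third, for a least-squares objective \<open>J = 1/2 * enorm r ^ 2\<close> a scaled gradient
  \<open>enorm (g k) / enorm (r (u k)) > \<epsilon>g\<close> means \<open>enorm (g k) ^ 2 \<ge> 2 * \<epsilon>g\<^sup>2 * J\<close>.  So a counted
  successful iteration multiplies \<open>J\<close> by at most \<open>1 - \<kappa>\<close>, where \<open>\<kappa>\<close> is a constant times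
  \<open>(1 - \<theta>\<^sup>2) * \<epsilon>g\<^sup>2\<close> (\<open>successful_contraction\<close>).  As \<open>J\<close> starts at \<open>J0\<close> and stays above
  \<open>\<epsilon>R\<^sup>2 / 2\<close> at the counted iterates, at most \<open>1 + ln (2 * J0 / \<epsilon>R\<^sup>2) / \<kappa>\<close> of them are successful
  (\<open>contraction_count\<close>).

  Finally, between \<open>\<gamma>min\<close> and \<open>L\<close> there is room only for a bounded number \<open>b\<close> of doublings, so that
  there are at most \<open>b\<close> unsuccessful iterations for each successful one (\<open>unsuccessful_bound\<close>).
\<close>

section \<open>The Euclidean norm and the spectral norm\<close>

lemma enorm_nonneg [simp]: "0 \<le> enorm v"
  by (simp add: enorm_def)

lemma enorm_power2: "(enorm v)\<^sup>2 = v \<bullet> v"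
  unfolding enorm_def L2_set_def scalar_prod_def
  by (simp add: sum_nonneg lessThan_atLeast0 power2_eq_square)

lemma enorm_zero_vec [simp]: "enorm (0\<^sub>v n) = 0"
  using enorm_power2[of "0\<^sub>v n"] by simp

lemma enorm_eq_0_iff:
  assumes "v \<in> carrier_vec n"
  shows "enorm v = 0 \<longleftrightarrow> v = 0\<^sub>v n"
  using assms by (auto simp: enorm_def L2_set_eq_0_iff intro!: eq_vecI)

lemma enorm_smult [simp]: "enorm (a \<cdot>\<^sub>v v) = \<bar>a\<bar> * enorm v"
  by (simp add: enorm_def L2_set_def power_mult_distrib real_sqrt_mult flip: sum_distrib_left)

lemma enorm_triangle:
  assumes "v \<in> carrier_vec n" "w \<in> carrier_vec n"
  shows "enorm (v + w) \<le> enorm v + enorm w"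
proof -
  have "enorm (v + w) = L2_set (\<lambda>i. v $ i + w $ i) {..<n}"
    using assms unfolding enorm_def by (intro L2_set_cong) auto
  also have "\<dots> \<le> L2_set (\<lambda>i. v $ i) {..<n} + L2_set (\<lambda>i. w $ i) {..<n}"
    by (rule L2_set_triangle_ineq)
  finally show ?thesis
    using assms by (simp add: enorm_def)
qed

lemma Cauchy_Schwarz_vec:
  assumes "v \<in> carrier_vec n" "w \<in> carrier_vec n"
  shows "\<bar>v \<bullet> w\<bar> \<le> enorm v * enorm w"
proof -
  have "\<bar>v \<bullet> w\<bar> \<le> (\<Sum>i\<in>{..<n}. \<bar>v $ i\<bar> * \<bar>w $ i\<bar>)"
    using assms by (auto simp: scalar_prod_def lessThan_atLeast0 abs_mult intro!: order.trans[OF sum_abs])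
  also have "\<dots> \<le> enorm v * enorm w"
    using L2_set_mult_ineq[of "\<lambda>i. v $ i" "\<lambda>i. w $ i" "{..<n}"] assms by (simp add: enorm_def)
  finally show ?thesis .
qed

lemma matrix_vector_bounded:
  assumes A: "A \<in> carrier_mat nr nc"
  obtains K where "0 \<le> K" "\<And>x. x \<in> carrier_vec nc \<Longrightarrow> enorm (A *\<^sub>v x) \<le> K * enorm x"
proof
  show "0 \<le> (\<Sum>i<nr. enorm (row A i))"
    by (simp add: sum_nonneg)
  fix x :: "real vec" assume x: "x \<in> carrier_vec nc"
  have "enorm (A *\<^sub>v x) \<le> (\<Sum>i<nr. \<bar>(A *\<^sub>v x) $ i\<bar>)"
    using A L2_set_le_sum_abs[of "\<lambda>i. (A *\<^sub>v x) $ i" "{..<nr}"] by (simp add: enorm_def)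
  also have "\<dots> \<le> (\<Sum>i<nr. enorm (row A i) * enorm x)"
    using A x by (intro sum_mono) (auto intro!: Cauchy_Schwarz_vec[of _ nc])
  finally show "enorm (A *\<^sub>v x) \<le> (\<Sum>i<nr. enorm (row A i)) * enorm x"
    by (simp add: sum_distrib_right)
qed

text \<open>A supremum of reals is an upper bound only if the set is bounded above, hence the appeal to
  the crude bound by the row norms.\<close>

lemma
  assumes A: "A \<in> carrier_mat nr nc"
  shows spectral_norm_nonneg: "0 \<le> spectral_norm A"
    and enorm_mult_mat_vec_le: "x \<in> carrier_vec nc \<Longrightarrow> enorm (A *\<^sub>v x) \<le> spectral_norm A * enorm x"
proof -
  obtain K where K: "0 \<le> K" "\<And>x. x \<in> carrier_vec nc \<Longrightarrow> enorm (A *\<^sub>v x) \<le> K * enorm x"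
    using matrix_vector_bounded[OF A] by blast
  have "enorm (A *\<^sub>v x) \<le> K" if "x \<in> carrier_vec nc" "enorm x \<le> 1" for x
    using K(2)[OF that(1)] mult_left_mono[OF that(2) K(1)] by simp
  then have "bdd_above ((\<lambda>x. enorm (A *\<^sub>v x)) ` {x \<in> carrier_vec (dim_col A). enorm x \<le> 1})"
    using A by (intro bdd_aboveI[of _ K]) auto
  then have upper: "enorm (A *\<^sub>v x) \<le> spectral_norm A" if "x \<in> carrier_vec nc" "enorm x \<le> 1" for x
    unfolding spectral_norm_def using that A by (intro cSUP_upper) auto
  show "0 \<le> spectral_norm A"
    using upper[of "0\<^sub>v nc"] order.trans[OF enorm_nonneg] by auto
  assume x: "x \<in> carrier_vec nc"
  show "enorm (A *\<^sub>v x) \<le> spectral_norm A * enorm x"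
  proof (cases "enorm x = 0")
    case True
    then show ?thesis using K(2)[OF x] by simp
  next
    case False
    then have pos: "0 < enorm x" by (simp add: less_le)
    have "enorm (A *\<^sub>v ((1 / enorm x) \<cdot>\<^sub>v x)) \<le> spectral_norm A"
      using x pos by (intro upper) auto
    also have "A *\<^sub>v ((1 / enorm x) \<cdot>\<^sub>v x) = (1 / enorm x) \<cdot>\<^sub>v (A *\<^sub>v x)"
      by (rule mult_mat_vec[OF A x])
    finally show ?thesis
      using pos by (simp add: field_simps)
  qed
qed

section \<open>Gradients\<close>

text \<open>Two gradients \<open>g\<close> and \<open>g'\<close> differ by a vector \<open>w\<close> with \<open>w \<bullet> h = o(enorm h)\<close>; the choice
  \<open>h = \<tau> w\<close> with \<open>\<tau> \<rightarrow> 0\<close> shows \<open>w \<bullet> w = 0\<close>.\<close>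

lemma has_gradient_unique:
  assumes "has_gradient n f g x" "has_gradient n f g' x"
  shows "g = g'"
proof -
  have g: "g \<in> carrier_vec n" and g': "g' \<in> carrier_vec n"
    using assms by (auto simp: has_gradient_def)
  define w where "w = g - g'"
  have w: "w \<in> carrier_vec n" using g g' by (simp add: w_def)
  have "enorm w = 0"
  proof (rule ccontr)
    assume "enorm w \<noteq> 0"
    then have pos: "0 < enorm w" by (simp add: less_le)
    define e where "e = enorm w / 4"
    have e: "0 < e" using pos by (simp add: e_def)
    obtain d d' where d: "0 < d" "0 < d'"
      and D: "\<And>h. h \<in> carrier_vec n \<Longrightarrow> enorm h < d \<Longrightarrow> \<bar>f (x + h) - f x - g \<bullet> h\<bar> \<le> e * enorm h"
      and D': "\<And>h. h \<in> carrier_vec n \<Longrightarrow> enorm h < d' \<Longrightarrow> \<bar>f (x + h) - f x - g' \<bullet> h\<bar> \<le> e * enorm h"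
      using assms e unfolding has_gradient_def by metis
    define \<tau> where "\<tau> = min d d' / (2 * enorm w)"
    have \<tau>: "0 < \<tau>" using d pos by (simp add: \<tau>_def)
    define h where "h = \<tau> \<cdot>\<^sub>v w"
    have h: "h \<in> carrier_vec n" using w by (simp add: h_def)
    have nh: "enorm h = \<tau> * enorm w" using \<tau> by (simp add: h_def)
    moreover have "\<tau> * enorm w = min d d' / 2" using pos by (simp add: \<tau>_def)
    ultimately have "enorm h < d" "enorm h < d'" using d by linarith+
    from D[OF h this(1)] D'[OF h this(2)] have "\<bar>g \<bullet> h - g' \<bullet> h\<bar> \<le> 2 * (e * enorm h)"
      by linarith
    moreover have "g \<bullet> h - g' \<bullet> h = \<tau> * (enorm w)\<^sup>2"
      using minus_scalar_prod_distrib[OF g g' h] w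
      by (simp add: enorm_power2 h_def flip: w_def)
    ultimately have "\<tau> * (enorm w)\<^sup>2 \<le> 2 * (e * (\<tau> * enorm w))"
      using \<tau> by (simp add: nh)
    also have "\<dots> = \<tau> * (enorm w)\<^sup>2 / 2"
      by (simp add: e_def power2_eq_square)
    finally show False using \<tau> pos by simp
  qed
  then have "g - g' = 0\<^sub>v n"
    using enorm_eq_0_iff[OF w] by (simp add: w_def)
  then have "g $ i - g' $ i = 0" if "i < n" for i
    using that g g' by (metis carrier_vecD index_minus_vec(1) index_zero_vec(1))
  then show ?thesis
    using g g' by (intro eq_vecI) auto
qed

text \<open>Chain rule for half the squared norm: with \<open>d = r (x + h) - r x\<close> and the linearization error
  \<open>e = d - G h\<close>, the increment is \<open>r x \<bullet> G h + r x \<bullet> e + enorm d ^ 2 / 2\<close>, where \<open>e\<close> is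
  \<open>o(enorm h)\<close> and \<open>d\<close> is \<open>O(enorm h)\<close>.\<close>

lemma has_gradient_objective:
  assumes r: "\<And>v. v \<in> carrier_vec n \<Longrightarrow> r v \<in> carrier_vec m"
    and x: "x \<in> carrier_vec n"
    and jac: "has_jacobian n m r (G x) x"
  shows "has_gradient n (objective r) (grad_GR r G x) x"
  unfolding has_gradient_def
proof (intro conjI allI impI)
  have G: "G x \<in> carrier_mat m n"
    using jac by (simp add: has_jacobian_def)
  then show "grad_GR r G x \<in> carrier_vec n"
    using r[OF x] by (auto simp: grad_GR_def)
  obtain K where K: "0 \<le> K" "\<And>h. h \<in> carrier_vec n \<Longrightarrow> enorm (G x *\<^sub>v h) \<le> K * enorm h"
    using matrix_vector_bounded[OF G] by blast
  fix \<epsilon> :: real assume \<epsilon>: "0 < \<epsilon>"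
  define \<delta> where "\<delta> = min 1 (\<epsilon> / (2 * (enorm (r x) + 1)))"
  have pos1: "0 < enorm (r x) + 1" by (simp add: add_nonneg_pos)
  have \<delta>: "0 < \<delta>" "\<delta> \<le> 1" and \<delta>r: "enorm (r x) * \<delta> \<le> \<epsilon> / 2"
  proof -
    show "0 < \<delta>" "\<delta> \<le> 1" using \<epsilon> pos1 by (auto simp: \<delta>_def)
    have "enorm (r x) * \<delta> \<le> (enorm (r x) + 1) * (\<epsilon> / (2 * (enorm (r x) + 1)))"
      using \<open>0 < \<delta>\<close> by (intro mult_mono) (auto simp: \<delta>_def)
    also have "\<dots> = \<epsilon> / 2" using pos1 by (simp add: field_simps)
    finally show "enorm (r x) * \<delta> \<le> \<epsilon> / 2" .
  qed
  obtain d0 where d0: "0 < d0" "\<And>h. h \<in> carrier_vec n \<Longrightarrow> enorm h < d0 \<Longrightarrow>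
      enorm (r (x + h) - r x - G x *\<^sub>v h) \<le> \<delta> * enorm h"
    using jac \<delta>(1) unfolding has_jacobian_def by metis
  define d1 where "d1 = min d0 (\<epsilon> / (K + 1)\<^sup>2)"
  show "\<exists>d>0. \<forall>h\<in>carrier_vec n. enorm h < d \<longrightarrow>
      \<bar>objective r (x + h) - objective r x - grad_GR r G x \<bullet> h\<bar> \<le> \<epsilon> * enorm h"
  proof (intro exI[of _ d1] conjI ballI impI)
    show "0 < d1" using d0 \<epsilon> K(1) by (auto simp: d1_def)
    fix h :: "real vec" assume h: "h \<in> carrier_vec n" and hd: "enorm h < d1"
    define d where "d = r (x + h) - r x"
    define e where "e = d - G x *\<^sub>v h"
    have rx: "r x \<in> carrier_vec m" and rxh: "r (x + h) \<in> carrier_vec m"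
      using x h r by auto
    have Gh: "G x *\<^sub>v h \<in> carrier_vec m" using G h by simp
    have d: "d \<in> carrier_vec m" using rx rxh by (simp add: d_def)
    have e: "e \<in> carrier_vec m" using d Gh by (simp add: e_def)
    have rxh_eq: "r (x + h) = r x + d" using rx rxh by (auto simp: d_def)
    have d_eq: "d = G x *\<^sub>v h + e" unfolding e_def using carrier_vecD[OF d] carrier_vecD[OF Gh] by (intro eq_vecI) auto
    have e_le: "enorm e \<le> \<delta> * enorm h"
      using d0(2)[OF h] hd by (simp add: d1_def e_def d_def)
    have "objective r (x + h) - objective r x = r x \<bullet> d + (enorm d)\<^sup>2 / 2"
      using rx d
      by (simp add: objective_def rxh_eq enorm_power2 scalar_prod_add_distrib[of _ m]
          add_scalar_prod_distrib[of _ m] comm_scalar_prod[of d m "r x"] field_simps)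
    also have "r x \<bullet> d = grad_GR r G x \<bullet> h + r x \<bullet> e"
      using rx e Gh h G transpose_vec_mult_scalar[OF G h rx]
      by (simp add: d_eq scalar_prod_add_distrib[of _ m] grad_GR_def)
    finally have "\<bar>objective r (x + h) - objective r x - grad_GR r G x \<bullet> h\<bar>
        \<le> \<bar>r x \<bullet> e\<bar> + (enorm d)\<^sup>2 / 2"
      by (simp add: abs_if)
    also have "\<bar>r x \<bullet> e\<bar> \<le> enorm (r x) * (\<delta> * enorm h)"
      using Cauchy_Schwarz_vec[OF rx e] e_le by (meson mult_left_mono enorm_nonneg order.trans)
    also have "\<dots> \<le> \<epsilon> / 2 * enorm h"
      using mult_right_mono[OF \<delta>r enorm_nonneg[of h]] by (simp add: mult.assoc)
    also have "(enorm d)\<^sup>2 / 2 \<le> \<epsilon> / 2 * enorm h"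
    proof -
      have "enorm d \<le> K * enorm h + 1 * enorm h"
        using enorm_triangle[OF Gh e] K(2)[OF h] e_le mult_right_mono[OF \<delta>(2) enorm_nonneg[of h]]
        by (simp add: d_eq)
      then have "enorm d \<le> (K + 1) * enorm h" by (simp add: algebra_simps)
      then have "(enorm d)\<^sup>2 \<le> ((K + 1) * enorm h)\<^sup>2" by (rule power_mono) simp
      also have "\<dots> = ((K + 1)\<^sup>2 * enorm h) * enorm h" by (simp add: power2_eq_square)
      also have "\<dots> \<le> \<epsilon> * enorm h"
      proof (rule mult_right_mono)
        have "enorm h \<le> \<epsilon> / (K + 1)\<^sup>2" using hd by (simp add: d1_def)
        then show "(K + 1)\<^sup>2 * enorm h \<le> \<epsilon>" using K(1) by (simp add: field_simps)
      qed simp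
      finally show ?thesis by simp
    qed
    finally show "\<bar>objective r (x + h) - objective r x - grad_GR r G x \<bullet> h\<bar> \<le> \<epsilon> * enorm h"
      by simp
  qed
qed

lemma has_gradient_along_line:
  assumes grad: "has_gradient n f g (x + \<tau> \<cdot>\<^sub>v s)"
    and x: "x \<in> carrier_vec n" and s: "s \<in> carrier_vec n"
  shows "((\<lambda>\<tau>. f (x + \<tau> \<cdot>\<^sub>v s)) has_real_derivative g \<bullet> s) (at \<tau>)"
  unfolding DERIV_def LIM_eq
proof (intro allI impI)
  fix e :: real assume e: "0 < e"
  have g: "g \<in> carrier_vec n" using grad by (simp add: has_gradient_def)
  have pos: "0 < enorm s + 1" by (simp add: add_nonneg_pos)
  have "0 < e / (enorm s + 1)" using e pos by simp
  then obtain d where d: "0 < d" and D: "\<And>h. h \<in> carrier_vec n \<Longrightarrow> enorm h < d \<Longrightarrow>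
      \<bar>f (x + \<tau> \<cdot>\<^sub>v s + h) - f (x + \<tau> \<cdot>\<^sub>v s) - g \<bullet> h\<bar> \<le> e / (enorm s + 1) * enorm h"
    using grad unfolding has_gradient_def by metis
  show "\<exists>d>0. \<forall>h. h \<noteq> 0 \<and> norm (h - 0) < d \<longrightarrow>
      norm ((f (x + (\<tau> + h) \<cdot>\<^sub>v s) - f (x + \<tau> \<cdot>\<^sub>v s)) / h - g \<bullet> s) < e"
  proof (intro exI[of _ "d / (enorm s + 1)"] conjI allI impI)
    show "0 < d / (enorm s + 1)" using d pos by simp
    fix h :: real assume h: "h \<noteq> 0 \<and> norm (h - 0) < d / (enorm s + 1)"
    have "\<bar>h\<bar> * enorm s \<le> \<bar>h\<bar> * (enorm s + 1)" by (simp add: mult_left_mono)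
    also have "\<dots> < d" using h pos by (simp add: field_simps)
    finally have "enorm (h \<cdot>\<^sub>v s) < d" by simp
    moreover have "x + (\<tau> + h) \<cdot>\<^sub>v s = x + \<tau> \<cdot>\<^sub>v s + h \<cdot>\<^sub>v s"
      using x s by (simp add: add_smult_distrib_vec assoc_add_vec[of _ n])
    ultimately have "\<bar>f (x + (\<tau> + h) \<cdot>\<^sub>v s) - f (x + \<tau> \<cdot>\<^sub>v s) - h * (g \<bullet> s)\<bar>
        \<le> e / (enorm s + 1) * (\<bar>h\<bar> * enorm s)"
      using D[of "h \<cdot>\<^sub>v s"] s g by simp
    also have "\<dots> = \<bar>h\<bar> * (e * (enorm s / (enorm s + 1)))" by simp
    also have "\<dots> < \<bar>h\<bar> * (e * 1)"
      using h e pos by (intro mult_strict_left_mono) (auto simp: field_simps)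
    finally have "\<bar>f (x + (\<tau> + h) \<cdot>\<^sub>v s) - f (x + \<tau> \<cdot>\<^sub>v s) - h * (g \<bullet> s)\<bar> / \<bar>h\<bar> < e"
      using h by (simp add: field_simps)
    moreover have "(f (x + (\<tau> + h) \<cdot>\<^sub>v s) - f (x + \<tau> \<cdot>\<^sub>v s)) / h - g \<bullet> s
        = (f (x + (\<tau> + h) \<cdot>\<^sub>v s) - f (x + \<tau> \<cdot>\<^sub>v s) - h * (g \<bullet> s)) / h"
      using h by (simp add: field_simps)
    ultimately show "norm ((f (x + (\<tau> + h) \<cdot>\<^sub>v s) - f (x + \<tau> \<cdot>\<^sub>v s)) / h - g \<bullet> s) < e"
      by (simp add: abs_divide)
  qed
qed

text \<open>The descent lemma: on the segment from \<open>x\<close> to \<open>x + s\<close>, the difference between \<open>f\<close> and the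
  quadratic upper model has a nonpositive derivative.\<close>

lemma descent_lemma:
  assumes grad: "\<And>v. v \<in> carrier_vec n \<Longrightarrow> has_gradient n f (grad v) v"
    and lip: "lipschitz_map n L grad"
    and x: "x \<in> carrier_vec n" and s: "s \<in> carrier_vec n"
  shows "f (x + s) \<le> f x + grad x \<bullet> s + L / 2 * (enorm s)\<^sup>2"
proof -
  have carr: "grad v \<in> carrier_vec n" if "v \<in> carrier_vec n" for v
    using grad[OF that] by (simp add: has_gradient_def)
  let ?\<phi> = "\<lambda>\<tau>. f (x + \<tau> \<cdot>\<^sub>v s) - \<tau> * (grad x \<bullet> s) - L / 2 * \<tau>\<^sup>2 * (enorm s)\<^sup>2"
  have "?\<phi> 1 \<le> ?\<phi> 0"
  proof (rule DERIV_nonpos_imp_nonincreasing[where f = ?\<phi>])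
    fix \<tau> :: real assume \<tau>: "0 \<le> \<tau>" "\<tau> \<le> 1"
    define v where "v = x + \<tau> \<cdot>\<^sub>v s"
    have v: "v \<in> carrier_vec n" using x s by (simp add: v_def)
    have "v - x = \<tau> \<cdot>\<^sub>v s" using x s by (auto simp: v_def)
    then have "enorm (grad v - grad x) \<le> L * (\<tau> * enorm s)"
      using lip v x \<tau> by (metis lipschitz_map_def enorm_smult abs_of_nonneg)
    moreover have "\<bar>(grad v - grad x) \<bullet> s\<bar> \<le> enorm (grad v - grad x) * enorm s"
      using carr v x s by (intro Cauchy_Schwarz_vec[of _ n]) auto
    moreover have "(grad v - grad x) \<bullet> s = grad v \<bullet> s - grad x \<bullet> s"
      using carr v x s by (intro minus_scalar_prod_distrib[of _ n]) auto
    ultimately have "grad v \<bullet> s - grad x \<bullet> s \<le> L * (\<tau> * enorm s) * enorm s"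
      by (smt (verit) mult_right_mono enorm_nonneg)
    then have "grad v \<bullet> s - grad x \<bullet> s - L / 2 * (2 * \<tau>) * (enorm s)\<^sup>2 \<le> 0"
      by (simp add: power2_eq_square algebra_simps)
    moreover have "(?\<phi> has_real_derivative
        grad v \<bullet> s - grad x \<bullet> s - L / 2 * (2 * \<tau>) * (enorm s)\<^sup>2) (at \<tau>)"
      using has_gradient_along_line[OF grad[OF v, unfolded v_def] x s]
      by (auto intro!: derivative_eq_intros simp: v_def)
    ultimately show "\<exists>y. (?\<phi> has_real_derivative y) (at \<tau>) \<and> y \<le> 0" by blast
  qed simp
  moreover have "x + 0 \<cdot>\<^sub>v s = x" using x s by auto
  ultimately show ?thesis by simp
qed

section \<open>Decrease of the regularized model\<close>

lemma regularized_carrier [simp]: "H \<in> carrier_mat n n \<Longrightarrow> regularized n H \<gamma> \<in> carrier_mat n n"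
  by (simp add: regularized_def)

lemma regularized_mult_vec:
  assumes "H \<in> carrier_mat n n" "x \<in> carrier_vec n"
  shows "regularized n H \<gamma> *\<^sub>v x = H *\<^sub>v x + \<gamma> \<cdot>\<^sub>v x"
proof -
  have "(\<gamma> \<cdot>\<^sub>m 1\<^sub>m n) *\<^sub>v x = \<gamma> \<cdot>\<^sub>v x"
    using assms(2) by (intro eq_vecI) auto
  then show ?thesis
    using assms by (simp add: regularized_def add_mult_distrib_mat_vec[of _ n n])
qed

lemma regularized_quadratic_form:
  assumes "H \<in> carrier_mat n n" "x \<in> carrier_vec n"
  shows "x \<bullet> (regularized n H \<gamma> *\<^sub>v x) = x \<bullet> (H *\<^sub>v x) + \<gamma> * (enorm x)\<^sup>2"
  using assms by (simp add: regularized_mult_vec scalar_prod_add_distrib[of _ n] enorm_power2)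

lemma symmetric_scalar_prod:
  assumes A: "A \<in> carrier_mat n n" and sym: "transpose_mat A = A"
    and x: "x \<in> carrier_vec n" and y: "y \<in> carrier_vec n"
  shows "x \<bullet> (A *\<^sub>v y) = y \<bullet> (A *\<^sub>v (x :: real vec))"
proof -
  have "x \<bullet> (A *\<^sub>v y) = (A *\<^sub>v x) \<bullet> y"
    using transpose_vec_mult_scalar[OF A y x] sym by simp
  also have "\<dots> = y \<bullet> (A *\<^sub>v x)"
    using A x y by (intro comm_scalar_prod[of _ n]) auto
  finally show ?thesis .
qed

text \<open>Let \<open>q x = g \<bullet> x + 1/2 * (x \<bullet> A x)\<close> with \<open>A = H + \<gamma> I\<close>.  The residual \<open>t\<close> is the gradient
  of \<open>q\<close> at \<open>s\<close>, and \<open>q\<close> is strongly convex with modulus \<open>\<gamma>\<close>; hence \<open>q s\<close> exceeds the value of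
  \<open>q\<close> at any other point by at most \<open>enorm t ^ 2 / (2 * \<gamma>)\<close>.  Comparison with the gradient step
  \<open>- \<alpha> g\<close>, \<open>\<alpha> = 1 / (spectral_norm H + \<gamma>)\<close>, gives the claim without an inverse of \<open>A\<close>.  The
  factor \<open>sqrt (\<gamma> / (spectral_norm H + \<gamma>))\<close> in the tolerance is exactly what makes the loss a
  multiple \<open>\<theta>\<^sup>2\<close> of the gain.\<close>

lemma inexact_step_model_decrease:
  assumes psd: "symmetric_psd n H" and \<gamma>: "0 < \<gamma>" and \<theta>: "0 \<le> \<theta>"
    and g: "grad_GR r G u \<in> carrier_vec n" and s: "s \<in> carrier_vec n"
    and step: "inexact_step n r G \<theta> u H \<gamma> s"
  shows "(1 - \<theta>\<^sup>2) / 2 * (enorm (grad_GR r G u))\<^sup>2 / (spectral_norm H + \<gamma>)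
    \<le> model n r G u H \<gamma> (0\<^sub>v n) - model n r G u H \<gamma> s"
proof -
  define g where "g = grad_GR r G u"
  define A where "A = regularized n H \<gamma>"
  define \<beta> where "\<beta> = spectral_norm H + \<gamma>"
  have H: "H \<in> carrier_mat n n" and sym: "transpose_mat H = H"
    and pos: "\<And>x. x \<in> carrier_vec n \<Longrightarrow> 0 \<le> x \<bullet> (H *\<^sub>v x)"
    using psd by (auto simp: symmetric_psd_def)
  have \<beta>: "0 < \<beta>" using spectral_norm_nonneg[OF H] \<gamma> by (simp add: \<beta>_def)
  have gc: "g \<in> carrier_vec n" using g by (simp add: g_def)
  have A: "A \<in> carrier_mat n n" using H by (simp add: A_def)
  obtain t where t: "t \<in> carrier_vec n" and As: "A *\<^sub>v s = - g + t"
    and t_le: "enorm t \<le> \<theta> * sqrt (\<gamma> / \<beta>) * enorm g"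
    using step by (auto simp: inexact_step_def A_def g_def \<beta>_def)
  have dims: "A *\<^sub>v s \<in> carrier_vec n" "A *\<^sub>v g \<in> carrier_vec n"
    using A s gc by auto
  define \<alpha> where "\<alpha> = 1 / \<beta>"
  have \<alpha>: "0 < \<alpha>" "\<alpha> * \<beta> = 1" using \<beta> by (auto simp: \<alpha>_def)
  define d where "d = s + \<alpha> \<cdot>\<^sub>v g"
  have d: "d \<in> carrier_vec n" using s gc by (simp add: d_def)
  have sAs: "s \<bullet> (A *\<^sub>v s) = t \<bullet> s - g \<bullet> s"
    using s t gc by (simp add: As scalar_prod_add_distrib[of _ n] comm_scalar_prod[of s n])
  have gAs: "g \<bullet> (A *\<^sub>v s) = t \<bullet> g - (enorm g)\<^sup>2"
    using s t gc
    by (simp add: As scalar_prod_add_distrib[of _ n] comm_scalar_prod[of g n t] enorm_power2)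
  have symA: "s \<bullet> (A *\<^sub>v g) = g \<bullet> (A *\<^sub>v s)"
  proof -
    have "transpose_mat (\<gamma> \<cdot>\<^sub>m 1\<^sub>m n) = \<gamma> \<cdot>\<^sub>m 1\<^sub>m n"
      by (intro eq_matI) auto
    then have "transpose_mat A = A"
      using H sym by (simp add: A_def regularized_def transpose_add[of _ n n])
    then show ?thesis using symmetric_scalar_prod[OF A _ s gc] by simp
  qed
  have gAg: "g \<bullet> (A *\<^sub>v g) \<le> \<beta> * (enorm g)\<^sup>2"
  proof -
    have "g \<bullet> (H *\<^sub>v g) \<le> enorm g * enorm (H *\<^sub>v g)"
      using Cauchy_Schwarz_vec[OF gc, of "H *\<^sub>v g"] H gc by auto
    also have "\<dots> \<le> enorm g * (spectral_norm H * enorm g)"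
      by (intro mult_left_mono enorm_mult_mat_vec_le[OF H gc]) simp
    finally show ?thesis
      using H gc by (simp add: A_def \<beta>_def regularized_quadratic_form power2_eq_square algebra_simps)
  qed
  have Ad: "A *\<^sub>v d = A *\<^sub>v s + \<alpha> \<cdot>\<^sub>v (A *\<^sub>v g)"
    using A s gc by (simp add: d_def mult_add_distrib_mat_vec[of _ n n] mult_mat_vec[of _ n n])
  have dAd: "d \<bullet> (A *\<^sub>v d) = s \<bullet> (A *\<^sub>v s) + 2 * \<alpha> * (g \<bullet> (A *\<^sub>v s)) + \<alpha>\<^sup>2 * (g \<bullet> (A *\<^sub>v g))"
  proof -
    have "d \<bullet> (A *\<^sub>v d) = s \<bullet> (A *\<^sub>v s) + \<alpha> * (s \<bullet> (A *\<^sub>v g))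
        + (\<alpha> * (g \<bullet> (A *\<^sub>v s)) + \<alpha> * (\<alpha> * (g \<bullet> (A *\<^sub>v g))))"
      unfolding Ad unfolding d_def using s gc dims
      by (simp add: scalar_prod_add_distrib[of _ n] add_scalar_prod_distrib[of _ n] algebra_simps)
    then show ?thesis by (simp add: symA power2_eq_square)
  qed
  have convex: "\<gamma> * (enorm d)\<^sup>2 \<le> d \<bullet> (A *\<^sub>v d)"
    using pos[OF d] H d by (simp add: A_def regularized_quadratic_form)
  have "t \<bullet> d \<le> enorm t * enorm d"
    using Cauchy_Schwarz_vec[OF t d] by simp
  also have "\<dots> \<le> \<gamma> / 2 * (enorm d)\<^sup>2 + (enorm t)\<^sup>2 / (2 * \<gamma>)"
  proof -
    have "0 \<le> (\<gamma> * enorm d - enorm t)\<^sup>2 / (2 * \<gamma>)" using \<gamma> by simp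
    then show ?thesis using \<gamma> by (simp add: field_simps power2_eq_square)
  qed
  also have "(enorm t)\<^sup>2 / (2 * \<gamma>) \<le> \<theta>\<^sup>2 * (\<alpha> / 2 * (enorm g)\<^sup>2)"
  proof -
    have "(enorm t)\<^sup>2 \<le> (\<theta> * sqrt (\<gamma> / \<beta>) * enorm g)\<^sup>2"
      using t_le by (rule power_mono) simp
    also have "\<dots> = \<theta>\<^sup>2 * (\<gamma> / \<beta>) * (enorm g)\<^sup>2"
      using \<gamma> \<beta> by (simp add: power_mult_distrib)
    finally show ?thesis using \<gamma> \<beta> by (simp add: \<alpha>_def field_simps)
  qed
  also have "t \<bullet> d = t \<bullet> s + \<alpha> * (t \<bullet> g)"
    using t s gc by (simp add: d_def scalar_prod_add_distrib[of _ n])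
  finally have td: "t \<bullet> s + \<alpha> * (t \<bullet> g)
      \<le> d \<bullet> (A *\<^sub>v d) / 2 + \<theta>\<^sup>2 * (\<alpha> / 2 * (enorm g)\<^sup>2)"
    using convex by simp
  have "\<alpha>\<^sup>2 * (g \<bullet> (A *\<^sub>v g)) \<le> \<alpha>\<^sup>2 * (\<beta> * (enorm g)\<^sup>2)"
    using gAg by (intro mult_left_mono) auto
  also have "\<dots> = \<alpha> * (enorm g)\<^sup>2"
    using \<alpha>(2) by (simp add: power2_eq_square algebra_simps)
  finally have quad: "\<alpha>\<^sup>2 * (g \<bullet> (A *\<^sub>v g)) \<le> \<alpha> * (enorm g)\<^sup>2" .
  have "(1 - \<theta>\<^sup>2) * (\<alpha> / 2 * (enorm g)\<^sup>2) \<le> - (g \<bullet> s) - (s \<bullet> (A *\<^sub>v s)) / 2"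
    using td quad sAs unfolding dAd gAs by (simp add: field_simps)
  also have "\<dots> = model n r G u H \<gamma> (0\<^sub>v n) - model n r G u H \<gamma> s"
    using gc A by (simp add: model_def g_def A_def)
  finally show ?thesis
    by (simp add: \<alpha>_def \<beta>_def g_def mult_ac)
qed

section \<open>Counting the iterations of a sequence\<close>

text \<open>On \<open>S\<close> the sequence contracts by \<open>1 - \<kappa> \<le> exp (- \<kappa>)\<close> while it stays above \<open>\<delta>\<close>, and elsewhere
  it does not increase.  The estimate is taken at the last index of a finite subset of \<open>S\<close>, where
  only the earlier contractions have occurred: this accounts for the summand \<open>1\<close>.\<close>

lemma contraction_count:
  fixes a :: "nat \<Rightarrow> real"
  assumes nonneg: "\<And>k. 0 \<le> a k" and decr: "\<And>k. a (Suc k) \<le> a k"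
    and contr: "\<And>k. k \<in> S \<Longrightarrow> a (Suc k) \<le> (1 - \<kappa>) * a k"
    and above: "\<And>k. k \<in> S \<Longrightarrow> \<delta> \<le> a k" and \<delta>: "0 < \<delta>" and \<kappa>: "0 < \<kappa>" and start: "\<delta> \<le> a 0"
  shows "finite S" "real (card S) \<le> 1 + ln (a 0 / \<delta>) / \<kappa>"
proof -
  have decay: "a k \<le> exp (- \<kappa> * real (card (S \<inter> {..<k}))) * a 0" for k
  proof (induction k)
    case 0
    then show ?case by simp
  next
    case (Suc k)
    show ?case
    proof (cases "k \<in> S")
      case True
      then have card: "card (S \<inter> {..<Suc k}) = Suc (card (S \<inter> {..<k}))"
        by (simp add: lessThan_Suc)
      have "1 - \<kappa> \<le> exp (- \<kappa>)" using exp_ge_add_one_self[of "- \<kappa>"] by simp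
      then have "a (Suc k) \<le> exp (- \<kappa>) * a k"
        using contr[OF True] nonneg[of k] by (meson mult_right_mono order.trans)
      also have "\<dots> \<le> exp (- \<kappa>) * (exp (- \<kappa> * real (card (S \<inter> {..<k}))) * a 0)"
        using Suc.IH by simp
      also have "\<dots> = exp (- \<kappa> * real (card (S \<inter> {..<Suc k}))) * a 0"
        by (simp add: card algebra_simps flip: exp_add)
      finally show ?thesis .
    next
      case False
      then show ?thesis
        using decr[of k] Suc.IH by (simp add: lessThan_Suc)
    qed
  qed
  have bound: "real (card F) \<le> 1 + ln (a 0 / \<delta>) / \<kappa>" if F: "F \<subseteq> S" "finite F" for F
  proof (cases "F = {}")
    case True
    then show ?thesis using start \<delta> \<kappa> by (simp add: field_simps)
  next
    case False
    define N where "N = Max F"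
    have N: "N \<in> F" using F False by (simp add: N_def)
    have "F \<subseteq> insert N (S \<inter> {..<N})"
      using F by (auto simp: N_def less_le)
    then have "card F \<le> Suc (card (S \<inter> {..<N}))"
      using card_mono[of "insert N (S \<inter> {..<N})" F] card_insert_le_m1 by (simp add: card_insert_if)
    then have "- \<kappa> * real (card (S \<inter> {..<N})) \<le> - \<kappa> * (real (card F) - 1)"
      using \<kappa> by simp
    moreover have "\<delta> \<le> a N" using above N F by auto
    ultimately have "\<delta> \<le> exp (- \<kappa> * (real (card F) - 1)) * a 0"
      using decay[of N] nonneg[of 0] by (smt (verit) exp_le_cancel_iff mult_right_mono)
    then have "exp (\<kappa> * (real (card F) - 1)) * \<delta>
        \<le> exp (\<kappa> * (real (card F) - 1)) * (exp (- \<kappa> * (real (card F) - 1)) * a 0)"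
      by simp
    also have "\<dots> = a 0"
      by (simp flip: mult.assoc exp_add)
    finally have "exp (\<kappa> * (real (card F) - 1)) \<le> a 0 / \<delta>"
      using \<delta> by (simp add: pos_le_divide_eq)
    then have "\<kappa> * (real (card F) - 1) \<le> ln (a 0 / \<delta>)"
      using start \<delta> by (subst ln_ge_iff) auto
    then show ?thesis using \<kappa> by (simp add: field_simps)
  qed
  show "finite S"
  proof (rule finite_if_finite_subsets_card_bdd[THEN conjunct1])
    fix F assume "F \<subseteq> S" "finite F"
    then show "card F \<le> nat \<lfloor>1 + ln (a 0 / \<delta>) / \<kappa>\<rfloor>"
      using bound by (intro le_nat_floor)
  qed
  then show "real (card S) \<le> 1 + ln (a 0 / \<delta>) / \<kappa>"
    using bound by simp
qed

lemma card_le_if_successor_within: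
  fixes S U :: "nat set"
  assumes S: "finite S" and succ: "\<And>k. k \<in> U \<Longrightarrow> \<exists>j\<in>{1..b}. k + j \<in> S"
  shows "finite U" "card U \<le> b * card S"
proof -
  have sub: "U \<subseteq> (\<lambda>(j, i). i - j) ` ({1..b} \<times> S)"
    using succ by (force simp: image_iff)
  show "finite U" using S finite_subset[OF sub] by simp
  show "card U \<le> b * card S"
    using surj_card_le[OF _ sub] S by (simp add: card_cartesian_product)
qed

section \<open>The regularization method\<close>

locale regularization_method =
  fixes n m :: nat and r :: "real vec \<Rightarrow> real vec" and G :: "real vec \<Rightarrow> real mat"
    and gradJ :: "real vec \<Rightarrow> real vec" and u0 :: "real vec"
    and H :: "nat \<Rightarrow> real mat" and s u :: "nat \<Rightarrow> real vec" and \<gamma> :: "nat \<Rightarrow> real"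
    and \<theta> L M\<^sub>H \<eta> \<gamma>0 \<gamma>min :: real
  assumes \<eta>: "0 < \<eta>" "\<eta> < 1" and \<gamma>min: "0 < \<gamma>min" "\<gamma>min \<le> \<gamma>0"
    and residual_carrier: "\<And>v. v \<in> carrier_vec n \<Longrightarrow> r v \<in> carrier_vec m"
    and jacobian: "\<And>v. v \<in> carrier_vec n \<Longrightarrow> has_jacobian n m r (G v) v"
    and u0: "u0 \<in> carrier_vec n"
    and run: "regularization_run n r G u0 \<gamma>0 \<gamma>min \<eta> H s u \<gamma>"
    and gradient: "\<And>v. v \<in> carrier_vec n \<Longrightarrow> has_gradient n (objective r) (gradJ v) v"
    and lipschitz: "lipschitz_map n L gradJ"
    and H_bound: "\<And>k. spectral_norm (H k) \<le> M\<^sub>H"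
    and H_psd: "\<And>k. symmetric_psd n (H k)"
    and \<theta>: "0 \<le> \<theta>" "\<theta> < 1"
    and step: "\<And>k. inexact_step n r G \<theta> (u k) (H k) (\<gamma> k) (s k)"
begin

abbreviation "g k \<equiv> grad_GR r G (u k)"

abbreviation "J k \<equiv> objective r (u k)"

abbreviation "model_decrease k \<equiv>
  model n r G (u k) (H k) (\<gamma> k) (0\<^sub>v n) - model n r G (u k) (H k) (\<gamma> k) (s k)"

abbreviation "accepted k \<equiv> \<eta> \<le> ratio n r G (u k) (H k) (\<gamma> k) (s k)"

lemma s_carrier: "s k \<in> carrier_vec n"
  using run by (simp add: regularization_run_def)

lemma H_carrier: "H k \<in> carrier_mat n n"
  using run by (simp add: regularization_run_def)

lemma u_0: "u 0 = u0" and \<gamma>_0: "\<gamma> 0 = \<gamma>0"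
  using run by (auto simp: regularization_run_def)

lemma update_zero_gradient:
  assumes "g k = 0\<^sub>v n"
  shows "u (Suc k) = u k" "\<gamma> (Suc k) = max (0.5 * \<gamma> k) \<gamma>min \<or> \<gamma> (Suc k) = 2 * \<gamma> k"
  using run assms unfolding regularization_run_def by metis+

lemma update_accepted:
  assumes "g k \<noteq> 0\<^sub>v n" "accepted k"
  shows "u (Suc k) = u k + s k" "\<gamma> (Suc k) = max (0.5 * \<gamma> k) \<gamma>min"
  using run assms unfolding regularization_run_def by metis+

lemma update_rejected:
  assumes "g k \<noteq> 0\<^sub>v n" "\<not> accepted k"
  shows "u (Suc k) = u k" "\<gamma> (Suc k) = 2 * \<gamma> k"
  using run assms unfolding regularization_run_def by metis+

lemma u_carrier: "u k \<in> carrier_vec n"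
proof (induction k)
  case 0
  then show ?case by (simp add: u_0 u0)
next
  case (Suc k)
  then show ?case
    using s_carrier[of k] update_zero_gradient(1)[of k] update_accepted(1)[of k]
      update_rejected(1)[of k] by (metis add_carrier_vec)
qed

lemma \<gamma>_ge_min: "\<gamma>min \<le> \<gamma> k"
proof (induction k)
  case 0
  then show ?case using \<gamma>min by (simp add: \<gamma>_0)
next
  case (Suc k)
  have "\<gamma> (Suc k) = max (0.5 * \<gamma> k) \<gamma>min \<or> \<gamma> (Suc k) = 2 * \<gamma> k"
    using update_zero_gradient(2) update_accepted(2) update_rejected(2) by blast
  then show ?case using Suc \<gamma>min by auto
qed

lemma \<gamma>_pos: "0 < \<gamma> k"
  using \<gamma>_ge_min[of k] \<gamma>min by linarith

lemma g_carrier: "g k \<in> carrier_vec n"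
  and g_eq_gradJ: "g k = gradJ (u k)"
proof -
  have *: "has_gradient n (objective r) (g k) (u k)"
    using residual_carrier jacobian u_carrier by (intro has_gradient_objective[of n r m]) auto
  then show "g k \<in> carrier_vec n" by (simp add: has_gradient_def)
  show "g k = gradJ (u k)"
    using has_gradient_unique[OF * gradient[OF u_carrier]] .
qed

lemma g_norm_pos: "g k \<noteq> 0\<^sub>v n \<Longrightarrow> 0 < enorm (g k)"
  using enorm_eq_0_iff[OF g_carrier] by (metis enorm_nonneg less_le)

lemma model_decrease_ge:
  "(1 - \<theta>\<^sup>2) / 2 * (enorm (g k))\<^sup>2 / (spectral_norm (H k) + \<gamma> k) \<le> model_decrease k"
  using inexact_step_model_decrease[OF H_psd \<gamma>_pos \<theta>(1) g_carrier s_carrier step] .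

lemma one_minus_\<theta>_pos: "0 < 1 - \<theta>\<^sup>2"
  using \<theta> by (simp add: abs_square_less_1)

lemma model_decrease_pos:
  assumes "g k \<noteq> 0\<^sub>v n"
  shows "0 < model_decrease k"
proof -
  have "0 < (1 - \<theta>\<^sup>2) / 2 * (enorm (g k))\<^sup>2 / (spectral_norm (H k) + \<gamma> k)"
    using one_minus_\<theta>_pos g_norm_pos[OF assms] spectral_norm_nonneg[OF H_carrier] \<gamma>_pos[of k]
    by (simp add: add_nonneg_pos)
  then show ?thesis using model_decrease_ge[of k] by linarith
qed

text \<open>A zero step would leave the model unchanged, so for a nonzero gradient the test on the ratio
  agrees with the definition of a successful iteration by the movement of the iterate.\<close>

lemma accepted_iff_moved:
  assumes "g k \<noteq> 0\<^sub>v n"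
  shows "accepted k \<longleftrightarrow> u (Suc k) \<noteq> u k"
proof
  assume acc: "accepted k"
  show "u (Suc k) \<noteq> u k"
  proof
    assume "u (Suc k) = u k"
    then have eq: "u k + s k = u k" using update_accepted(1)[OF assms acc] by simp
    have "s k = (u k + s k) - u k"
      using s_carrier[of k] u_carrier[of k] by auto
    also have "\<dots> = 0\<^sub>v n" using u_carrier[of k] by (simp add: eq)
    finally have "s k = 0\<^sub>v n" .
    then show False using model_decrease_pos[OF assms] by simp
  qed
next
  assume "u (Suc k) \<noteq> u k"
  then show "accepted k" using update_rejected(1)[OF assms] by blast
qed

text \<open>As \<open>H k\<close> is positive semidefinite, the model at \<open>\<gamma> k \<ge> L\<close> dominates the quadratic upper bound
  of the descent lemma.  The ratio is then at least \<open>1\<close>.\<close>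

lemma accepted_if_large_\<gamma>:
  assumes "g k \<noteq> 0\<^sub>v n" "L \<le> \<gamma> k"
  shows "accepted k"
proof -
  have "objective r (u k + s k) \<le> J k + g k \<bullet> s k + L / 2 * (enorm (s k))\<^sup>2"
    using descent_lemma[OF gradient lipschitz u_carrier s_carrier] by (simp add: g_eq_gradJ)
  moreover have "L / 2 * (enorm (s k))\<^sup>2 \<le> \<gamma> k / 2 * (enorm (s k))\<^sup>2"
    using assms(2) by (simp add: mult_right_mono)
  moreover have "0 \<le> s k \<bullet> (H k *\<^sub>v s k)"
    using H_psd s_carrier by (simp add: symmetric_psd_def)
  moreover have "model_decrease k
      = - (g k \<bullet> s k) - (s k \<bullet> (H k *\<^sub>v s k)) / 2 - \<gamma> k / 2 * (enorm (s k))\<^sup>2"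
    using g_carrier[of k] mult_mat_vec_carrier[OF regularized_carrier[OF H_carrier[of k]] zero_carrier_vec]
    by (simp add: model_def regularized_quadratic_form[OF H_carrier s_carrier] field_simps)
  ultimately have "model_decrease k \<le> J k - objective r (u k + s k)" by linarith
  then have "1 \<le> ratio n r G (u k) (H k) (\<gamma> k) (s k)"
    using model_decrease_pos[OF assms(1)] by (simp add: ratio_def)
  then show ?thesis using \<eta> by linarith
qed

lemma accepted_decrease:
  assumes "g k \<noteq> 0\<^sub>v n" "accepted k"
  shows "\<eta> * model_decrease k \<le> J k - J (Suc k)"
  using assms(2) model_decrease_pos[OF assms(1)] update_accepted(1)[OF assms]
  by (simp add: ratio_def field_simps)

lemma J_decreasing: "J (Suc k) \<le> J k"
proof (cases "g k \<noteq> 0\<^sub>v n \<and> accepted k")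
  case True
  then have "0 < \<eta> * model_decrease k" using model_decrease_pos \<eta> by simp
  then show ?thesis using accepted_decrease[of k] True by linarith
next
  case False
  then have "u (Suc k) = u k"
    using update_zero_gradient(1) update_rejected(1) by blast
  then show ?thesis by simp
qed

lemma J_nonneg: "0 \<le> J k"
  by (simp add: objective_def)

text \<open>The parameter is doubled only below \<open>L\<close>, as long as the gradient does not vanish; and since the
  iterates freeze at a zero gradient, a nonzero gradient has only nonzero gradients before it.\<close>

lemma \<gamma>_le_max:
  assumes "g k \<noteq> 0\<^sub>v n"
  shows "\<gamma> k \<le> max \<gamma>0 (2 * L)"
  using assms
proof (induction k)
  case 0
  then show ?case by (simp add: \<gamma>_0)
next
  case (Suc k)
  have nz: "g k \<noteq> 0\<^sub>v n"
    using Suc.prems update_zero_gradient(1)[of k] by auto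
  note IH = Suc.IH[OF nz]
  show ?case
  proof (cases "accepted k")
    case True
    then show ?thesis using update_accepted(2)[OF nz] IH \<gamma>min \<gamma>_pos[of k] by auto
  next
    case False
    then have "\<gamma> k < L" using accepted_if_large_\<gamma>[OF nz] by force
    then show ?thesis using update_rejected(2)[OF nz False] by auto
  qed
qed

lemma accepted_within:
  assumes b: "L \<le> 2 ^ b * \<gamma>min" and nz: "g k \<noteq> 0\<^sub>v n"
  shows "\<exists>j\<le>b. u (k + j) = u k \<and> accepted (k + j)"
proof (rule ccontr)
  assume none: "\<not> ?thesis"
  have "u (k + j) = u k \<and> \<gamma> (k + j) = 2 ^ j * \<gamma> k" if "j \<le> b" for j
    using that
  proof (induction j)
    case 0
    then show ?case by simp
  next
    case (Suc j)
    then have IH: "u (k + j) = u k" "\<gamma> (k + j) = 2 ^ j * \<gamma> k" by auto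
    moreover have "\<not> accepted (k + j)" using none IH(1) Suc.prems by auto
    ultimately show ?case using update_rejected[of "k + j"] nz by simp
  qed
  from this[of b] have ub: "u (k + b) = u k" and "\<gamma> (k + b) = 2 ^ b * \<gamma> k" by auto
  moreover have "2 ^ b * \<gamma>min \<le> 2 ^ b * \<gamma> k" using \<gamma>_ge_min[of k] by simp
  ultimately have "L \<le> \<gamma> (k + b)" "g (k + b) \<noteq> 0\<^sub>v n"
    using b nz by (linarith, simp)
  then have "accepted (k + b)" using accepted_if_large_\<gamma> by blast
  then show False using none ub by blast
qed

lemma not_stationary_D:
  assumes "\<not> approx_stationary r G \<epsilon>g \<epsilon>R (u k)" "0 < \<epsilon>g" "0 < \<epsilon>R"
  shows "\<epsilon>R < enorm (r (u k))" "\<epsilon>g * enorm (r (u k)) < enorm (g k)" "g k \<noteq> 0\<^sub>v n"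
proof -
  show r: "\<epsilon>R < enorm (r (u k))" using assms(1) by (simp add: approx_stationary_def)
  then have "0 < enorm (r (u k))" using assms(3) by linarith
  then show lt: "\<epsilon>g * enorm (r (u k)) < enorm (g k)"
    using assms(1) by (simp add: approx_stationary_def field_simps)
  have "0 < enorm (g k)"
    using lt assms(2) \<open>0 < enorm (r (u k))\<close> by (smt (verit) mult_pos_pos)
  then show "g k \<noteq> 0\<^sub>v n" by (metis enorm_zero_vec less_irrefl)
qed

text \<open>Away from approximate stationarity \<open>enorm (g k) ^ 2 \<ge> \<epsilon>g\<^sup>2 * enorm (r (u k)) ^ 2 = 2 * \<epsilon>g\<^sup>2 * J k\<close>, so
  the decrease, which is proportional to the squared gradient, is a fixed fraction of \<open>J k\<close>.  This
  is the source of the logarithm in the complexity bound.\<close>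

lemma successful_contraction:
  assumes k: "k \<in> successful_its r G u \<epsilon>g \<epsilon>R" and \<epsilon>: "0 < \<epsilon>g" "0 < \<epsilon>R"
  shows "J (Suc k) \<le> (1 - \<eta> * (1 - \<theta>\<^sup>2) * \<epsilon>g\<^sup>2 / (M\<^sub>H + max \<gamma>0 (2 * L))) * J k"
proof -
  define \<Gamma> where "\<Gamma> = M\<^sub>H + max \<gamma>0 (2 * L)"
  have ns: "\<not> approx_stationary r G \<epsilon>g \<epsilon>R (u k)" and moved: "u (Suc k) \<noteq> u k"
    using k by (auto simp: successful_its_def)
  note D = not_stationary_D[OF ns \<epsilon>]
  have acc: "accepted k" using accepted_iff_moved[OF D(3)] moved by simp
  have "spectral_norm (H k) + \<gamma> k \<le> \<Gamma>"
    using H_bound[of k] \<gamma>_le_max[OF D(3)] by (simp add: \<Gamma>_def)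
  moreover have "0 < spectral_norm (H k) + \<gamma> k"
    using spectral_norm_nonneg[OF H_carrier[of k]] \<gamma>_pos[of k] by linarith
  moreover have "2 * \<epsilon>g\<^sup>2 * J k \<le> (enorm (g k))\<^sup>2"
  proof -
    have "(\<epsilon>g * enorm (r (u k)))\<^sup>2 \<le> (enorm (g k))\<^sup>2"
      using D(2) \<epsilon> by (intro power_mono) auto
    then show ?thesis by (simp add: objective_def power_mult_distrib)
  qed
  ultimately have "(1 - \<theta>\<^sup>2) / 2 * (2 * \<epsilon>g\<^sup>2 * J k) / \<Gamma> \<le> model_decrease k"
    using one_minus_\<theta>_pos
    by (intro order.trans[OF _ model_decrease_ge[of k]] frac_le mult_left_mono) auto
  then have "\<eta> * ((1 - \<theta>\<^sup>2) / 2 * (2 * \<epsilon>g\<^sup>2 * J k) / \<Gamma>) \<le> J k - J (Suc k)"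
    using accepted_decrease[OF D(3) acc] \<eta> by (smt (verit) mult_left_mono)
  also have "\<eta> * ((1 - \<theta>\<^sup>2) / 2 * (2 * \<epsilon>g\<^sup>2 * J k) / \<Gamma>) = \<eta> * (1 - \<theta>\<^sup>2) * \<epsilon>g\<^sup>2 / \<Gamma> * J k"
    by simp
  finally show ?thesis unfolding \<Gamma>_def[symmetric] left_diff_distrib by simp
qed

lemma successful_bound:
  fixes \<epsilon>g \<epsilon>R
  assumes L: "0 < L" and M: "0 < M\<^sub>H" and \<epsilon>: "0 < \<epsilon>g" "0 < \<epsilon>R"
  defines "S \<equiv> successful_its r G u \<epsilon>g \<epsilon>R"
  shows "finite S"
    "S \<noteq> {} \<Longrightarrow> real (card S) \<le> 1 + (M\<^sub>H + max \<gamma>0 (2 * L)) / (\<eta> * (1 - \<theta>\<^sup>2) * \<epsilon>g\<^sup>2) * ln (2 * J 0 / \<epsilon>R\<^sup>2)"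
proof -
  define \<kappa> where "\<kappa> = \<eta> * (1 - \<theta>\<^sup>2) * \<epsilon>g\<^sup>2 / (M\<^sub>H + max \<gamma>0 (2 * L))"
  have \<kappa>: "0 < \<kappa>"
    using one_minus_\<theta>_pos \<eta> \<epsilon> L M by (auto simp: \<kappa>_def intro!: divide_pos_pos add_pos_pos)
  have above: "\<epsilon>R\<^sup>2 / 2 \<le> J k" if "k \<in> S" for k
  proof -
    have "\<epsilon>R\<^sup>2 \<le> (enorm (r (u k)))\<^sup>2"
      using that not_stationary_D(1)[OF _ \<epsilon>, of k] \<epsilon>
      by (intro power_mono) (auto simp: S_def successful_its_def)
    then show ?thesis by (simp add: objective_def)
  qed
  have start: "\<epsilon>R\<^sup>2 / 2 \<le> J 0" if "k \<in> S" for k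
    using above[OF that] lift_Suc_antimono_le[of J 0 k] J_decreasing by fastforce
  have contr: "J (Suc k) \<le> (1 - \<kappa>) * J k" if "k \<in> S" for k
    using successful_contraction[OF _ \<epsilon>] that by (simp add: S_def \<kappa>_def)
  have "finite S \<and> real (card S) \<le> 1 + ln (J 0 / (\<epsilon>R\<^sup>2 / 2)) / \<kappa>" if "k \<in> S" for k
    using contraction_count[of J S \<kappa> "\<epsilon>R\<^sup>2 / 2", OF J_nonneg J_decreasing contr above _ \<kappa> start[OF that]]
      \<epsilon> by simp
  moreover have "J 0 / (\<epsilon>R\<^sup>2 / 2) = 2 * J 0 / \<epsilon>R\<^sup>2" by simp
  moreover have "x / \<kappa> = (M\<^sub>H + max \<gamma>0 (2 * L)) / (\<eta> * (1 - \<theta>\<^sup>2) * \<epsilon>g\<^sup>2) * x" for x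
    by (simp add: \<kappa>_def)
  ultimately have *: "finite S \<and> real (card S)
      \<le> 1 + (M\<^sub>H + max \<gamma>0 (2 * L)) / (\<eta> * (1 - \<theta>\<^sup>2) * \<epsilon>g\<^sup>2) * ln (2 * J 0 / \<epsilon>R\<^sup>2)" if "k \<in> S" for k
    using that by metis
  then show "finite S" by (cases "S = {}") auto
  show "real (card S) \<le> 1 + (M\<^sub>H + max \<gamma>0 (2 * L)) / (\<eta> * (1 - \<theta>\<^sup>2) * \<epsilon>g\<^sup>2) * ln (2 * J 0 / \<epsilon>R\<^sup>2)"
    if "S \<noteq> {}" using that * by auto
qed

text \<open>An unsuccessful iteration keeps the iterate and doubles the parameter, which is at least
  \<open>\<gamma>min\<close>; so a successful iteration from the same iterate follows within \<open>b\<close> steps.  Balancing all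
  doublings against all halvings would not do: iterations at approximately stationary iterates also
  change the parameter, but are not counted.\<close>

lemma unsuccessful_bound:
  fixes \<epsilon>g \<epsilon>R
  assumes b: "L \<le> 2 ^ b * \<gamma>min" and \<epsilon>: "0 < \<epsilon>g" "0 < \<epsilon>R"
    and fin: "finite (successful_its r G u \<epsilon>g \<epsilon>R)"
  shows "finite (unsuccessful_its r G u \<epsilon>g \<epsilon>R)"
    "card (unsuccessful_its r G u \<epsilon>g \<epsilon>R) \<le> b * card (successful_its r G u \<epsilon>g \<epsilon>R)"
proof -
  have *: "\<exists>j\<in>{1..b}. k + j \<in> successful_its r G u \<epsilon>g \<epsilon>R"
    if k: "k \<in> unsuccessful_its r G u \<epsilon>g \<epsilon>R" for k
  proof -
    have ns: "\<not> approx_stationary r G \<epsilon>g \<epsilon>R (u k)" and stay: "u (Suc k) = u k"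
      using k by (auto simp: unsuccessful_its_def)
    note nz = not_stationary_D(3)[OF ns \<epsilon>]
    obtain j where j: "j \<le> b" "u (k + j) = u k" "accepted (k + j)"
      using accepted_within[OF b nz] by blast
    have "j \<noteq> 0" using j(3) stay accepted_iff_moved[OF nz] by (intro notI) simp
    moreover have "k + j \<in> successful_its r G u \<epsilon>g \<epsilon>R"
      using j(2,3) ns nz accepted_iff_moved[of "k + j"] by (simp add: successful_its_def)
    ultimately show ?thesis using j(1) by (intro bexI[of _ j]) auto
  qed
  show "finite (unsuccessful_its r G u \<epsilon>g \<epsilon>R)"
    "card (unsuccessful_its r G u \<epsilon>g \<epsilon>R) \<le> b * card (successful_its r G u \<epsilon>g \<epsilon>R)"
    using card_le_if_successor_within[OF fin *] by auto
qed

end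

section \<open>The complexity bound\<close>

lemma state_carrier:
  assumes "implicit_problem ny n m p R c" "v \<in> carrier_vec n"
  shows "state ny p c v \<in> carrier_vec ny"
proof -
  have "\<exists>!y. y \<in> carrier_vec ny \<and> c y v = 0\<^sub>v p"
    using assms unfolding implicit_problem_def by blast
  from theI'[OF this] show ?thesis by (simp add: state_def)
qed

lemma reduced_residual_carrier:
  assumes "implicit_problem ny n m p R c" "v \<in> carrier_vec n"
  shows "reduced_residual ny p R c v \<in> carrier_vec m"
  using assms state_carrier[OF assms] by (simp add: implicit_problem_def reduced_residual_def)

theorem theorem3p2:
  fixes L M\<^sub>H \<eta> \<gamma>0 \<gamma>min J0 :: real
  assumes "0 < L" and "0 < M\<^sub>H" and "0 < \<eta>" and "\<eta> < 1"
    and "0 < \<gamma>0" and "0 < \<gamma>min" and "\<gamma>min \<le> \<gamma>0"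
  shows "\<exists>C \<epsilon>bar :: real. 0 < C \<and> 0 < \<epsilon>bar \<and> \<epsilon>bar < 1 \<and>
    (\<forall>(ny::nat) (n::nat) (m::nat) (p::nat)
       (R :: real vec \<Rightarrow> real vec \<Rightarrow> real vec) (c :: real vec \<Rightarrow> real vec \<Rightarrow> real vec)
       (r :: real vec \<Rightarrow> real vec) (G :: real vec \<Rightarrow> real mat) (gradJ :: real vec \<Rightarrow> real vec)
       (u0 :: real vec) (H :: nat \<Rightarrow> real mat) (s :: nat \<Rightarrow> real vec) (u :: nat \<Rightarrow> real vec)
       (\<gamma> :: nat \<Rightarrow> real) (\<theta> :: real).
       implicit_problem ny n m p R c \<longrightarrow>
       r = reduced_residual ny p R c \<longrightarrow>
       (\<forall>v \<in> carrier_vec n. has_jacobian n m r (G v) v) \<longrightarrow>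
       u0 \<in> carrier_vec n \<longrightarrow>
       objective r u0 = J0 \<longrightarrow>
       regularization_run n r G u0 \<gamma>0 \<gamma>min \<eta> H s u \<gamma> \<longrightarrow>
       continuously_differentiable n (objective r) gradJ \<longrightarrow>
       lipschitz_map n L gradJ \<longrightarrow>
       (\<forall>k. spectral_norm (H k) \<le> M\<^sub>H) \<longrightarrow>
       (\<forall>k. symmetric_psd n (H k)) \<longrightarrow>
       0 \<le> \<theta> \<longrightarrow> \<theta> < 1 \<longrightarrow>
       (\<forall>k. inexact_step n r G \<theta> (u k) (H k) (\<gamma> k) (s k)) \<longrightarrow>
       (\<forall>\<epsilon>g \<epsilon>R :: real. 0 < \<epsilon>g \<longrightarrow> \<epsilon>g < 1 \<longrightarrow> 0 < \<epsilon>R \<longrightarrow> \<epsilon>R \<le> \<epsilon>bar \<longrightarrow>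
         (let S = successful_its r G u \<epsilon>g \<epsilon>R;
              U = unsuccessful_its r G u \<epsilon>g \<epsilon>R;
              B = C * (1 / (1 - \<theta>\<^sup>2)\<^sup>2) * ln (1 / \<epsilon>R) * (1 / \<epsilon>g\<^sup>2)
          in finite S \<and> finite U \<and>
             real (card S) \<le> B \<and>
             real (step_calculations S) \<le> B \<and>
             real (card S + card U) \<le> B \<and>
             real (residual_evaluations (S \<union> U)) \<le> B)))"
proof -
  obtain b :: nat where "L / \<gamma>min < 2 ^ b"
    using real_arch_pow[of 2 "L / \<gamma>min"] by auto
  then have b: "L \<le> 2 ^ b * \<gamma>min"
    using assms(6) by (simp add: field_simps)
  define K where "K = (M\<^sub>H + max \<gamma>0 (2 * L)) / \<eta>"
  define \<Lambda> where "\<Lambda> = max 0 (ln (2 * J0))"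
  define A where "A = 1 + K * (\<Lambda> + 2)"
  \<comment> \<open>The summand \<open>1\<close> pays for the residual at the starting point.\<close>
  define C where "C = 1 + (1 + real b) * A"
  have K: "0 < K" using assms by (auto simp: K_def intro!: divide_pos_pos add_pos_pos)
  have A: "0 < A" using K by (auto simp: A_def \<Lambda>_def intro!: add_pos_nonneg mult_nonneg_nonneg)
  have C: "0 < C" using A by (auto simp: C_def intro!: add_pos_nonneg mult_nonneg_nonneg)
  \<comment> \<open>For \<open>\<epsilon>R \<le> exp (- 1)\<close> the logarithm is at least \<open>1\<close> and absorbs the additive constants.\<close>
  show ?thesis
  proof (rule exI[of _ C], rule exI[of _ "exp (- 1)"], intro conjI allI impI)
    show "0 < C" by (rule C)
    show "0 < exp (- 1 :: real)" "exp (- 1 :: real) < 1" by auto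
    fix ny n m p R c r G gradJ u0 H s u \<gamma> and \<theta> \<epsilon>g \<epsilon>R :: real
    assume prob: "implicit_problem ny n m p R c"
      and r: "r = reduced_residual ny p R c"
      and jac: "\<forall>v\<in>carrier_vec n. has_jacobian n m r (G v) v"
      and u0: "u0 \<in> carrier_vec n" and J0: "objective r u0 = J0"
      and run: "regularization_run n r G u0 \<gamma>0 \<gamma>min \<eta> H s u \<gamma>"
      and diff: "continuously_differentiable n (objective r) gradJ"
      and lip: "lipschitz_map n L gradJ"
      and HM: "\<forall>k. spectral_norm (H k) \<le> M\<^sub>H" and psd: "\<forall>k. symmetric_psd n (H k)"
      and \<theta>: "0 \<le> \<theta>" "\<theta> < 1"
      and step: "\<forall>k. inexact_step n r G \<theta> (u k) (H k) (\<gamma> k) (s k)"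
      and \<epsilon>g: "0 < \<epsilon>g" "\<epsilon>g < 1" and \<epsilon>R: "0 < \<epsilon>R" "\<epsilon>R \<le> exp (- 1)"
    interpret regularization_method n m r G gradJ u0 H s u \<gamma> \<theta> L M\<^sub>H \<eta> \<gamma>0 \<gamma>min
      using assms jac u0 run diff lip HM psd \<theta> step reduced_residual_carrier[OF prob]
      by unfold_locales (auto simp: r continuously_differentiable_def)
    define S where "S = successful_its r G u \<epsilon>g \<epsilon>R"
    define U where "U = unsuccessful_its r G u \<epsilon>g \<epsilon>R"
    define l where "l = ln (1 / \<epsilon>R)"
    define q where "q = 1 / (1 - \<theta>\<^sup>2)"
    define e where "e = 1 / \<epsilon>g\<^sup>2"
    define X where "X = q\<^sup>2 * l * e"
    have l: "1 \<le> l"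
      using \<epsilon>R ln_mono[of \<epsilon>R "exp (- 1)"] by (simp add: l_def ln_div)
    have q: "1 \<le> q" using one_minus_\<theta>_pos by (simp add: q_def)
    have e: "1 \<le> e" using \<epsilon>g by (simp add: e_def power_le_one)
    have "1 * 1 * 1 \<le> X"
      unfolding X_def using l q e by (intro mult_mono) auto
    then have X: "1 \<le> X" by simp
    have finS: "finite S"
      using successful_bound(1)[OF assms(1,2) \<epsilon>g(1) \<epsilon>R(1)] by (simp add: S_def)
    have U: "finite U" "card U \<le> b * card S"
      using unsuccessful_bound[OF b \<epsilon>g(1) \<epsilon>R(1)] finS by (auto simp: S_def U_def)
    \<comment> \<open>For \<open>J0 = 0\<close> the left-hand side is \<open>ln 0 = 0\<close>.\<close>
    have log: "ln (2 * J0 / \<epsilon>R\<^sup>2) \<le> (\<Lambda> + 2) * l"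
    proof (cases "J0 = 0")
      case True
      then show ?thesis using l by (simp add: \<Lambda>_def)
    next
      case False
      then have "0 < J0" using J_nonneg[of 0] u_0 J0 by simp
      then have "ln (2 * J0 / \<epsilon>R\<^sup>2) = ln (2 * J0) + 2 * l"
        using \<epsilon>R by (simp add: l_def ln_div ln_mult ln_realpow)
      also have "ln (2 * J0) \<le> \<Lambda> * 1" by (simp add: \<Lambda>_def)
      also have "\<Lambda> * 1 \<le> \<Lambda> * l" using l by (intro mult_left_mono) (auto simp: \<Lambda>_def)
      finally show ?thesis by (simp add: algebra_simps)
    qed
    have S: "real (card S) \<le> A * X"
    proof (cases "S = {}")
      case True
      then show ?thesis using A X by simp
    next
      case False
      then have "real (card S) \<le> 1 + K * q * e * ln (2 * J0 / \<epsilon>R\<^sup>2)"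
        using successful_bound(2)[OF assms(1,2) \<epsilon>g(1) \<epsilon>R(1)] u_0 J0
        by (simp add: S_def K_def q_def e_def mult_ac)
      also have "K * q * e * ln (2 * J0 / \<epsilon>R\<^sup>2) \<le> K * q * e * ((\<Lambda> + 2) * l)"
        using log K q e by (intro mult_left_mono) auto
      \<comment> \<open>The contraction rate gives the first power of \<open>q\<close>, which is at most the second.\<close>
      also have "\<dots> \<le> K * q\<^sup>2 * e * ((\<Lambda> + 2) * l)"
        using K q e l by (intro mult_right_mono mult_left_mono self_le_power) (auto simp: \<Lambda>_def)
      also have "\<dots> = K * (\<Lambda> + 2) * X" by (simp add: X_def)
      finally show ?thesis using X by (simp add: A_def algebra_simps)
    qed
    have "real (card S) + real (card U) \<le> real (card S) + real b * real (card S)"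
      using U(2) by (simp flip: of_nat_mult)
    also have "\<dots> = (1 + real b) * real (card S)" by (simp add: algebra_simps)
    also have "\<dots> \<le> (1 + real b) * (A * X)" using S by (intro mult_left_mono) auto
    finally have "1 + (real (card S) + real (card U)) \<le> X + (1 + real b) * (A * X)"
      using X by simp
    also have "\<dots> = C * X" by (simp add: C_def algebra_simps)
    finally have total: "1 + (real (card S) + real (card U)) \<le> C * X" .
    have "card (S \<union> U) \<le> card S + card U" by (rule card_Un_le)
    then have "real (residual_evaluations (S \<union> U)) \<le> C * X"
      using total by (simp add: residual_evaluations_def)
    moreover have "C * X = C * (1 / (1 - \<theta>\<^sup>2)\<^sup>2) * ln (1 / \<epsilon>R) * (1 / \<epsilon>g\<^sup>2)"
      by (simp add: X_def q_def l_def e_def power_divide)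
    ultimately show "let S = successful_its r G u \<epsilon>g \<epsilon>R;
        U = unsuccessful_its r G u \<epsilon>g \<epsilon>R;
        B = C * (1 / (1 - \<theta>\<^sup>2)\<^sup>2) * ln (1 / \<epsilon>R) * (1 / \<epsilon>g\<^sup>2)
      in finite S \<and> finite U \<and> real (card S) \<le> B \<and> real (step_calculations S) \<le> B \<and>
         real (card S + card U) \<le> B \<and> real (residual_evaluations (S \<union> U)) \<le> B"
      using finS U(1) total unfolding Let_def S_def[symmetric] U_def[symmetric]
      by (simp add: step_calculations_def)
  qed
qed

end
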